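(* Let $\alpha\in(0,1)$ and $\beta\in(0,1-\alpha)$. The critical separation for goodness-of-fit testing, $\epsilon_*(n,t)=\inf\{\epsilon:R_*(\epsilon)\le\beta\}$, satisfies $$\epsilon_*(n,t)\ \gtrsim\ \max\left(\frac1t,\ \frac1{\sqrt{t\log n}},\ \frac1{\sqrt n}\right),$$ i.e. there exist a constant $C>0$ and an integer $n_0$, depending only on $\alpha,\beta$, such that $\epsilon_*(n,t)\ge C\max\big(\frac1t,\frac1{\sqrt{t\log n}},\frac1{\sqrt n}\big)$ for all $n\ge n_0$ and all $t\ge1$.
   Context: $D$ is the set of all probability distributions on $[0,1]$. For $\pi\in D$, $P_\pi$ is the binomial mixture on $\{0,\dots,t\}$ with $P_\pi(\{j\})=E_{p\sim\pi}\big[\binom tj p^j(1-p)^{t-j}\big]$, and $P_\pi^n$ its $n$-fold product. $W_1$ is the 1-Wasserstein distance. A test is a map $\psi:\{0,\dots,t\}^n\to\{0,1\}$. For $\pi_0\in D$, $\Psi(\pi_0)=\{\psi:P_{\pi_0}^n(\psi(X)=1)\le\alpha\}$ is the set of valid tests and $$R_*(\epsilon,\pi_0)=\inf_{\psi\in\Psi(\pi_0)}\ \sup_{\pi\in D:\,W_1(\pi,\pi_0)\ge\epsilon}P_\pi^n(\psi(X)=0),\qquad R_*(\epsilon)=\sup_{\pi_0\in D}R_*(\epsilon,\pi_0),$$ with the supremum over an empty set equal to $0$. *)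

theory Defs
  imports "HOL-Probability.Probability"
begin

text \<open>Distributions on [0,1] are rendered as Borel probability measures on the real line giving
  full mass to [0,1].\<close>

definition D :: "real measure set" where
  "D = {\<pi>. prob_space \<pi> \<and> sets \<pi> = sets borel \<and> emeasure \<pi> {0..1} = 1}"

definition couplings :: "real measure \<Rightarrow> real measure \<Rightarrow> (real \<times> real) measure set" where
  "couplings \<mu> \<nu> = {\<gamma>. sets \<gamma> = sets (borel \<Otimes>\<^sub>M borel) \<and> distr \<gamma> borel fst = \<mu> \<and> distr \<gamma> borel snd = \<nu>}"

definition W1 :: "real measure \<Rightarrow> real measure \<Rightarrow> ennreal" where
  "W1 \<mu> \<nu> = (INF \<gamma>\<in>couplings \<mu> \<nu>. \<integral>\<^sup>+ z. ennreal \<bar>fst z - snd z\<bar> \<partial>\<gamma>)"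

definition binomial_mixture :: "nat \<Rightarrow> real measure \<Rightarrow> nat measure" where
  "binomial_mixture t \<pi> = point_measure {0..t}
     (\<lambda>j. ennreal (\<integral>p. real (t choose j) * p ^ j * (1 - p) ^ (t - j) \<partial>\<pi>))"

definition sample_dist :: "nat \<Rightarrow> nat \<Rightarrow> real measure \<Rightarrow> (nat \<Rightarrow> nat) measure" where
  "sample_dist n t \<pi> = (\<Pi>\<^sub>M i\<in>{..<n}. binomial_mixture t \<pi>)"

definition reject_prob :: "nat \<Rightarrow> nat \<Rightarrow> real measure \<Rightarrow> ((nat \<Rightarrow> nat) \<Rightarrow> nat) \<Rightarrow> ennreal" where
  "reject_prob n t \<pi> \<psi> =
     emeasure (sample_dist n t \<pi>) {X \<in> space (sample_dist n t \<pi>). \<psi> X = 1}"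

definition accept_prob :: "nat \<Rightarrow> nat \<Rightarrow> real measure \<Rightarrow> ((nat \<Rightarrow> nat) \<Rightarrow> nat) \<Rightarrow> ennreal" where
  "accept_prob n t \<pi> \<psi> =
     emeasure (sample_dist n t \<pi>) {X \<in> space (sample_dist n t \<pi>). \<psi> X = 0}"

definition tests :: "nat \<Rightarrow> nat \<Rightarrow> ((nat \<Rightarrow> nat) \<Rightarrow> nat) set" where
  "tests n t = ({..<n} \<rightarrow>\<^sub>E {0..t}) \<rightarrow> {0, 1}"

definition valid_tests :: "real \<Rightarrow> nat \<Rightarrow> nat \<Rightarrow> real measure \<Rightarrow> ((nat \<Rightarrow> nat) \<Rightarrow> nat) set" where
  "valid_tests \<alpha> n t \<pi>\<^sub>0 = {\<psi> \<in> tests n t. reject_prob n t \<pi>\<^sub>0 \<psi> \<le> ennreal \<alpha>}"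

text \<open>The risks take values in \<^typ>\<open>ennreal\<close>, where the supremum over an empty set is 0.\<close>

definition local_risk :: "real \<Rightarrow> nat \<Rightarrow> nat \<Rightarrow> real \<Rightarrow> real measure \<Rightarrow> ennreal" where
  "local_risk \<alpha> n t \<epsilon> \<pi>\<^sub>0 =
     (INF \<psi>\<in>valid_tests \<alpha> n t \<pi>\<^sub>0. SUP \<pi>\<in>{\<pi> \<in> D. W1 \<pi> \<pi>\<^sub>0 \<ge> ennreal \<epsilon>}. accept_prob n t \<pi> \<psi>)"

definition global_risk :: "real \<Rightarrow> nat \<Rightarrow> nat \<Rightarrow> real \<Rightarrow> ennreal" where
  "global_risk \<alpha> n t \<epsilon> = (SUP \<pi>\<^sub>0\<in>D. local_risk \<alpha> n t \<epsilon> \<pi>\<^sub>0)"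

text \<open>The infimum below is over a nonempty set of positive reals when 0 < \<alpha> and 0 < \<beta> < 1 - \<alpha>:
  the set contains every \<epsilon> > 1, as W1 is at most 1 on D, and no \<epsilon> \<le> 0, as then the null itself is
  among the alternatives and the risk is at least 1 - \<alpha>.\<close>

definition critical_separation :: "real \<Rightarrow> real \<Rightarrow> nat \<Rightarrow> nat \<Rightarrow> real" where
  "critical_separation \<alpha> \<beta> n t = Inf {\<epsilon>. global_risk \<alpha> n t \<epsilon> \<le> ennreal \<beta>}"

end

theory Submission
  imports Defs
begin

text \<open>
  The proof is Le Cam's two-point method. If \<open>\<pi>\<^sub>0\<close> and \<open>\<pi>\<close> are at distance \<open>W1 \<pi> \<pi>\<^sub>0 \<ge> d\<close>, but the laws
  of the samples are so close that every test of level \<open>\<alpha>\<close> accepts under \<open>\<pi>\<close> with probability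
  greater than \<open>\<beta>\<close>, then the critical separation is at least \<open>d\<close> (\<open>critical_separation_ge\<close>).
  Closeness is measured by the chi-square divergence, because it tensorises: a divergence
  \<open>\<kappa>\<close> between single observations becomes \<open>(1 + \<kappa>) ^ n - 1\<close> between samples of size \<open>n\<close>, so that
  \<open>\<kappa> \<le> c / n\<close> with a small constant \<open>c\<close> is enough (\<open>accept_prob_ge_chi_square\<close>).
  The distance is bounded from below by integrating a Lipschitz function
  (\<open>W1_ge_of_lipschitz\<close>). There remains to exhibit pairs of priors.

  \<^item> For \<open>1 / sqrt n\<close>, both priors live on \<open>{0, 1}\<close>, with weights \<open>1/2\<close> and \<open>1/2\<close> for the null and
    \<open>1/2 - h\<close> and \<open>1/2 + h\<close> for the alternative, where \<open>h\<close> is of order \<open>1 / sqrt n\<close>.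

  \<^item> For the other two rates, take the \<open>2 * N\<close> points \<open>1/2 + \<delta> * cos (k * \<pi> / N)\<close>. One prior gives equal
    weight to the even values of \<open>k\<close>, the other to the odd values, and both put mass \<open>1/2\<close> on the
    point \<open>1/2\<close>. The two priors have the same moments of order less than \<open>N\<close>
    (\<open>sum_alternating_cos_power\<close>), whereas the function \<open>sin\<^sup>2 \<theta> * cos (N * \<theta>)\<close> of \<open>cos \<theta>\<close>, which is
    \<open>N + 2\<close>-Lipschitz, separates them: \<open>W1\<close> is at least of order \<open>\<delta> / N\<close> (\<open>W1_cheb_ge\<close>).
    Relative to the binomial law with parameter \<open>1/2\<close>, which the common atom keeps below the law of an
    observation up to a factor \<open>2\<close>, the divergence is a weighted sum of squares of the moment
    differences (\<open>chi_square_mixture_le\<close>).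
    With \<open>N = t + 1\<close> and \<open>\<delta> = 1/2\<close> it vanishes, which gives the rate \<open>1 / t\<close>.
    With \<open>N\<close> of order \<open>ln n\<close> and \<open>\<delta>\<close> of order \<open>sqrt (N / t)\<close> it is at most
    \<open>2 * exp (- N) \<le> c / n\<close>, and \<open>\<delta> / N\<close> is of order \<open>1 / sqrt (t * ln n)\<close>.
    This choice requires \<open>\<delta> \<le> 1/2\<close>; otherwise \<open>t < ln n\<close>, and the rate \<open>1 / t\<close> dominates.\<close>

section \<open>The chi-square bound on the error of a test\<close>

text \<open>The total variation distance is at most the square root of the chi-square divergence, here written
as \<open>\<Sum> Q\<^sup>2 / P - 1\<close>. Outcomes with \<open>P g = 0\<close> contribute \<open>0\<close> to the sum, which is harmless as \<open>Q\<close> vanishes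
there too.\<close>

lemma event_prob_diff_le_chi_square:
  fixes P Q :: "'a \<Rightarrow> real"
  assumes fin: "finite \<Omega>" and A: "A \<subseteq> \<Omega>"
    and P: "\<And>g. g \<in> \<Omega> \<Longrightarrow> 0 \<le> P g" and sP: "sum P \<Omega> = 1" and sQ: "sum Q \<Omega> = 1"
    and ac: "\<And>g. g \<in> \<Omega> \<Longrightarrow> P g = 0 \<Longrightarrow> Q g = 0"
  shows "sum P A - sum Q A \<le> sqrt ((\<Sum>g\<in>\<Omega>. (Q g)\<^sup>2 / P g) - 1)"
proof (rule real_le_rsqrt)
  let ?a = "\<lambda>g. (P g - Q g) / sqrt (P g)" and ?b = "\<lambda>g. sqrt (P g)"
  have "sum P A - sum Q A = (\<Sum>g\<in>A. ?a g * ?b g)"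
    unfolding sum_subtractf[symmetric] using A ac P
    by (intro sum.cong) (fastforce)+
  then have "(sum P A - sum Q A)\<^sup>2 \<le> (\<Sum>g\<in>A. (?a g)\<^sup>2) * (\<Sum>g\<in>A. (?b g)\<^sup>2)"
    using Cauchy_Schwarz_ineq_sum[of ?a ?b A] by simp
  also have "\<dots> \<le> (\<Sum>g\<in>\<Omega>. (?a g)\<^sup>2) * (\<Sum>g\<in>\<Omega>. (?b g)\<^sup>2)"
    using fin A by (intro mult_mono sum_mono2 sum_nonneg) auto
  also have "(\<Sum>g\<in>\<Omega>. (?b g)\<^sup>2) = 1"
    using sP P by (simp cong: sum.cong)
  also have "(\<Sum>g\<in>\<Omega>. (?a g)\<^sup>2) = (\<Sum>g\<in>\<Omega>. P g - 2 * Q g + (Q g)\<^sup>2 / P g)"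
  proof (rule sum.cong)
    fix g assume g: "g \<in> \<Omega>"
    show "(?a g)\<^sup>2 = P g - 2 * Q g + (Q g)\<^sup>2 / P g"
      using P[OF g] ac[OF g]
      by (cases "P g = 0") (auto simp: power_divide power2_eq_square field_simps)
  qed simp
  also have "\<dots> = 1 - 2 + (\<Sum>g\<in>\<Omega>. (Q g)\<^sup>2 / P g)"
    using sP sQ by (simp add: sum.distrib sum_subtractf flip: sum_distrib_left)
  finally show "(sum P A - sum Q A)\<^sup>2 \<le> (\<Sum>g\<in>\<Omega>. (Q g)\<^sup>2 / P g) - 1" by simp
qed

lemma sum_PiE_prod_const:
  fixes f :: "'b \<Rightarrow> real"
  assumes "finite B"
  shows "(\<Sum>g\<in>{..<n::nat} \<rightarrow>\<^sub>E B. \<Prod>i<n. f (g i)) = (sum f B) ^ n"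
  using prod_sum_PiE[of "{..<n}" "\<lambda>_. B" "\<lambda>_. f"] assms by simp

lemma sample_dist_point_mass:
  fixes p :: "nat \<Rightarrow> real"
  assumes M: "binomial_mixture t \<pi> = point_measure {0..t} (\<lambda>j. ennreal (p j))"
    and p: "\<And>j. j \<le> t \<Longrightarrow> 0 \<le> p j" and s: "(\<Sum>j\<in>{0..t}. p j) = 1"
  shows "space (sample_dist n t \<pi>) = {..<n} \<rightarrow>\<^sub>E {0..t}"
    and "A \<subseteq> {..<n} \<rightarrow>\<^sub>E {0..t} \<Longrightarrow>
      emeasure (sample_dist n t \<pi>) A = ennreal (\<Sum>g\<in>A. \<Prod>i<n. p (g i))"
proof -
  let ?M = "point_measure {0..t} (\<lambda>j. ennreal (p j))"
  let ?\<Omega> = "{..<n} \<rightarrow>\<^sub>E {0..t}"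
  have prob: "prob_space ?M"
  proof (rule prob_space_point_measure)
    have "(\<Sum>j\<in>{0..t}. ennreal (p j)) = ennreal (\<Sum>j\<in>{0..t}. p j)"
      using p by (intro sum_ennreal) auto
    then show "(\<Sum>j\<in>{0..t}. ennreal (p j)) = 1" by (simp only: s ennreal_1)
  qed simp_all
  interpret M: prob_space ?M by fact
  interpret product_sigma_finite "\<lambda>_::nat. ?M"
    by (simp add: product_sigma_finite_def M.sigma_finite_measure_axioms)
  have S: "sample_dist n t \<pi> = PiM {..<n} (\<lambda>_. ?M)"
    by (simp add: sample_dist_def M)
  show sp: "space (sample_dist n t \<pi>) = ?\<Omega>"
    by (simp add: S space_PiM space_point_measure)
  have fin: "finite ?\<Omega>" by (rule finite_PiE) simp_all
  have single: "{g} \<in> sets (sample_dist n t \<pi>)"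
    "emeasure (sample_dist n t \<pi>) {g} = ennreal (\<Prod>i<n. p (g i))" if g: "g \<in> ?\<Omega>" for g
  proof -
    have e: "{g} = PiE {..<n} (\<lambda>i. {g i})"
      by (rule PiE_singleton[symmetric]) (use g in \<open>simp add: PiE_def\<close>)
    have gi: "g i \<le> t" if "i < n" for i using PiE_mem[OF g] that by force
    show "{g} \<in> sets (sample_dist n t \<pi>)"
      unfolding S by (subst e, rule sets_PiM_I_finite) (use gi in \<open>auto simp: sets_point_measure\<close>)
    have "emeasure (sample_dist n t \<pi>) {g} = (\<Prod>i<n. emeasure ?M {g i})"
      unfolding S by (subst e, rule emeasure_PiM) (use gi in \<open>auto simp: sets_point_measure\<close>)
    also have "\<dots> = (\<Prod>i<n. ennreal (p (g i)))"
      using gi by (intro prod.cong) (auto simp: emeasure_point_measure_finite)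
    also have "\<dots> = ennreal (\<Prod>i<n. p (g i))"
      using gi p by (intro prod_ennreal) auto
    finally show "emeasure (sample_dist n t \<pi>) {g} = ennreal (\<Prod>i<n. p (g i))" .
  qed
  show "emeasure (sample_dist n t \<pi>) A = ennreal (\<Sum>g\<in>A. \<Prod>i<n. p (g i))" if A: "A \<subseteq> ?\<Omega>"
  proof -
    have "emeasure (sample_dist n t \<pi>) A = (\<Sum>g\<in>A. emeasure (sample_dist n t \<pi>) {g})"
      by (rule emeasure_eq_sum_singleton) (use A single(1) finite_subset[OF A fin] in blast)+
    also have "\<dots> = (\<Sum>g\<in>A. ennreal (\<Prod>i<n. p (g i)))"
      by (rule sum.cong) (use A single(2) in blast)+
    also have "\<dots> = ennreal (\<Sum>g\<in>A. \<Prod>i<n. p (g i))"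
    proof (intro sum_ennreal prod_nonneg)
      fix g i assume "g \<in> A" "i \<in> {..<n}"
      then have "g i \<in> {0..t}" using A by blast
      then show "0 \<le> p (g i)" using p by simp
    qed
    finally show ?thesis .
  qed
qed

text \<open>Le Cam's inequality for one alternative: a test of level \<open>\<alpha>\<close> accepts under the null with probability at
least \<open>1 - \<alpha>\<close>, and passing to the alternative costs at most the square root of the chi-square
divergence between the product laws.\<close>

lemma accept_prob_ge_chi_square:
  fixes p q :: "nat \<Rightarrow> real"
  assumes M0: "binomial_mixture t \<pi>\<^sub>0 = point_measure {0..t} (\<lambda>j. ennreal (p j))"
    and M1: "binomial_mixture t \<pi> = point_measure {0..t} (\<lambda>j. ennreal (q j))"
    and p: "\<And>j. j \<le> t \<Longrightarrow> 0 \<le> p j" "(\<Sum>j\<in>{0..t}. p j) = 1"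
    and q: "\<And>j. j \<le> t \<Longrightarrow> 0 \<le> q j" "(\<Sum>j\<in>{0..t}. q j) = 1"
    and ac: "\<And>j. j \<le> t \<Longrightarrow> p j = 0 \<Longrightarrow> q j = 0"
    and chi: "(\<Sum>j\<in>{0..t}. (q j - p j)\<^sup>2 / p j) \<le> \<kappa>"
    and psi: "\<psi> \<in> valid_tests \<alpha> n t \<pi>\<^sub>0" and \<alpha>: "0 \<le> \<alpha>"
  shows "accept_prob n t \<pi> \<psi> \<ge> ennreal (1 - \<alpha> - sqrt ((1 + \<kappa>) ^ n - 1))"
proof -
  let ?\<Omega> = "{..<n} \<rightarrow>\<^sub>E {0..t}"
  let ?P = "\<lambda>g. \<Prod>i<n. p (g i)" and ?Q = "\<lambda>g. \<Prod>i<n. q (g i)"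
  let ?R = "{g \<in> ?\<Omega>. \<psi> g = 1}" and ?A = "{g \<in> ?\<Omega>. \<psi> g = 0}"
  note s0 = sample_dist_point_mass[OF M0 p] and s1 = sample_dist_point_mass[OF M1 q]
  have fin: "finite ?\<Omega>" by (rule finite_PiE) simp_all
  have Pn: "0 \<le> ?P g" if "g \<in> ?\<Omega>" for g
    using that p(1) by (intro prod_nonneg) (auto simp: PiE_iff)
  have sumP: "sum ?P ?\<Omega> = 1" and sumQ: "sum ?Q ?\<Omega> = 1"
    by (simp_all only: sum_PiE_prod_const[OF finite_atLeastAtMost] p(2) q(2) power_one)
  have "ennreal (sum ?P ?R) \<le> ennreal \<alpha>"
    using psi s0(2)[of ?R n] by (simp add: valid_tests_def reject_prob_def s0(1))
  then have R: "sum ?P ?R \<le> \<alpha>" using \<alpha> by (simp add: ennreal_le_iff)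
  have "?\<Omega> = ?R \<union> ?A" using psi by (auto simp: valid_tests_def tests_def Pi_iff)
  then have "sum ?P ?\<Omega> = sum ?P (?R \<union> ?A)" by metis
  also have "\<dots> = sum ?P ?R + sum ?P ?A"
  proof (rule sum.union_disjoint)
    show "finite ?R" "finite ?A" by (rule finite_subset[OF _ fin], blast)+
    show "?R \<inter> ?A = {}" by fastforce
  qed
  finally have PA: "sum ?P ?A \<ge> 1 - \<alpha>" using R sumP by linarith
  \<comment> \<open>The sums of \<open>q\<^sup>2 / p\<close>, unlike those of \<open>(q - p)\<^sup>2 / p\<close>, multiply over the coordinates.\<close>
  have "(\<Sum>j\<in>{0..t}. (q j)\<^sup>2 / p j) = (\<Sum>j\<in>{0..t}. (q j - p j)\<^sup>2 / p j + (2 * q j - p j))"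
  proof (rule sum.cong)
    fix j assume "j \<in> {0..t}"
    then show "(q j)\<^sup>2 / p j = (q j - p j)\<^sup>2 / p j + (2 * q j - p j)"
      using ac[of j] by (cases "p j = 0") (auto simp: power2_eq_square field_simps)
  qed simp
  also have "\<dots> \<le> 1 + \<kappa>"
    using chi p(2) q(2) by (simp add: sum.distrib sum_subtractf flip: sum_distrib_left)
  finally have one: "(\<Sum>j\<in>{0..t}. (q j)\<^sup>2 / p j) \<le> 1 + \<kappa>" .
  have "(\<Sum>g\<in>?\<Omega>. (?Q g)\<^sup>2 / ?P g) = (\<Sum>g\<in>?\<Omega>. \<Prod>i<n. (q (g i))\<^sup>2 / p (g i))"
    by (simp add: prod_dividef prod_power_distrib)
  also have "\<dots> = (\<Sum>j\<in>{0..t}. (q j)\<^sup>2 / p j) ^ n"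
    by (rule sum_PiE_prod_const) simp
  also have "\<dots> \<le> (1 + \<kappa>) ^ n"
    using one p(1) by (intro power_mono sum_nonneg) auto
  finally have chi_n: "(\<Sum>g\<in>?\<Omega>. (?Q g)\<^sup>2 / ?P g) \<le> (1 + \<kappa>) ^ n" .
  have "sum ?P ?A - sum ?Q ?A \<le> sqrt ((\<Sum>g\<in>?\<Omega>. (?Q g)\<^sup>2 / ?P g) - 1)"
  proof (rule event_prob_diff_le_chi_square[OF fin _ Pn sumP sumQ])
    fix g assume "g \<in> ?\<Omega>" "?P g = 0"
    then show "?Q g = 0" using ac by (fastforce simp: PiE_iff)
  qed auto
  also have "\<dots> \<le> sqrt ((1 + \<kappa>) ^ n - 1)" using chi_n by simp
  finally have "1 - \<alpha> - sqrt ((1 + \<kappa>) ^ n - 1) \<le> sum ?Q ?A" using PA by linarith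
  then have "ennreal (1 - \<alpha> - sqrt ((1 + \<kappa>) ^ n - 1)) \<le> ennreal (sum ?Q ?A)"
    by (rule ennreal_leI)
  also have "\<dots> = accept_prob n t \<pi> \<psi>"
    using s1(2)[of ?A n] by (simp add: accept_prob_def s1(1))
  finally show ?thesis .
qed

section \<open>Bounds on the Wasserstein distance\<close>

text \<open>The easy half of Kantorovich-Rubinstein duality.\<close>

lemma W1_ge_of_lipschitz:
  fixes f :: "real \<Rightarrow> real"
  assumes pi: "\<pi> \<in> D" "\<pi>\<^sub>0 \<in> D"
    and L: "0 < L" "\<And>x y. \<bar>f x - f y\<bar> \<le> L * \<bar>x - y\<bar>" and bd: "\<And>x. \<bar>f x\<bar> \<le> B"
    and d: "L * d \<le> (\<integral>x. f x \<partial>\<pi>) - (\<integral>x. f x \<partial>\<pi>\<^sub>0)"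
  shows "W1 \<pi> \<pi>\<^sub>0 \<ge> ennreal d"
  unfolding W1_def
proof (rule INF_greatest)
  fix \<gamma> assume g: "\<gamma> \<in> couplings \<pi> \<pi>\<^sub>0"
  then have sg[measurable_cong]: "sets \<gamma> = sets (borel \<Otimes>\<^sub>M borel)"
    and m: "distr \<gamma> borel fst = \<pi>" "distr \<gamma> borel snd = \<pi>\<^sub>0" by (auto simp: couplings_def)
  have "continuous_on UNIV f"
    using L by (intro lipschitz_on_continuous_on[of L]) (auto simp: lipschitz_on_def dist_real_def)
  then have [measurable]: "f \<in> borel_measurable borel" by (rule borel_measurable_continuous_onI)
  have "prob_space \<pi>" using pi by (simp add: D_def)
  then have "prob_space (distr \<gamma> borel fst)" by (simp add: m)
  then interpret prob_space \<gamma> by (rule prob_space_distrD[rotated]) measurable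
  have i1: "integrable \<gamma> (\<lambda>z. f (fst z))" and i2: "integrable \<gamma> (\<lambda>z. f (snd z))"
    using bd by (auto intro!: integrable_const_bound[where B = B])
  have "(\<integral>x. f x \<partial>\<pi>) = (\<integral>z. f (fst z) \<partial>\<gamma>)" "(\<integral>x. f x \<partial>\<pi>\<^sub>0) = (\<integral>z. f (snd z) \<partial>\<gamma>)"
    unfolding m[symmetric] by (subst integral_distr; simp)+
  then have "L * d \<le> (\<integral>z. f (fst z) - f (snd z) \<partial>\<gamma>)" using d i1 i2 by simp
  also have "\<dots> \<le> (\<integral>z. \<bar>f (fst z) - f (snd z)\<bar> \<partial>\<gamma>)"
    using i1 i2 by (intro integral_mono) auto
  finally have "ennreal (L * d) \<le> ennreal (\<integral>z. \<bar>f (fst z) - f (snd z)\<bar> \<partial>\<gamma>)" by (rule ennreal_leI)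
  also have "\<dots> = (\<integral>\<^sup>+z. ennreal \<bar>f (fst z) - f (snd z)\<bar> \<partial>\<gamma>)"
    using i1 i2 by (intro nn_integral_eq_integral[symmetric]) auto
  also have "\<dots> \<le> (\<integral>\<^sup>+z. ennreal L * ennreal \<bar>fst z - snd z\<bar> \<partial>\<gamma>)"
    using L by (intro nn_integral_mono) (simp add: ennreal_mult[symmetric] ennreal_leI)
  also have "\<dots> = ennreal L * (\<integral>\<^sup>+z. ennreal \<bar>fst z - snd z\<bar> \<partial>\<gamma>)"
    by (rule nn_integral_cmult) measurable
  finally have "ennreal L * ennreal d \<le> ennreal L * (\<integral>\<^sup>+z. ennreal \<bar>fst z - snd z\<bar> \<partial>\<gamma>)"
    using L by (simp add: ennreal_mult')
  then show "ennreal d \<le> (\<integral>\<^sup>+z. ennreal \<bar>fst z - snd z\<bar> \<partial>\<gamma>)"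
    using L(1) by (subst (asm) ennreal_mult_le_mult_iff) auto
qed

text \<open>Bounded by means of the product coupling. It is used only to see that the infimum which defines the
critical separation is over a nonempty set.\<close>

lemma W1_le_1:
  assumes "\<pi> \<in> D" "\<pi>\<^sub>0 \<in> D"
  shows "W1 \<pi> \<pi>\<^sub>0 \<le> 1"
proof -
  have prob: "prob_space \<pi>" "prob_space \<pi>\<^sub>0" and sets[measurable_cong]: "sets \<pi> = sets borel" "sets \<pi>\<^sub>0 = sets borel"
    and e: "emeasure \<pi> {0..1} = 1" "emeasure \<pi>\<^sub>0 {0..1} = 1" using assms by (auto simp: D_def)
  interpret A: prob_space \<pi> by fact
  interpret B: prob_space \<pi>\<^sub>0 by fact
  interpret pair_prob_space \<pi> \<pi>\<^sub>0 by unfold_locales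
  have sp: "sets (\<pi> \<Otimes>\<^sub>M \<pi>\<^sub>0) = sets (borel \<Otimes>\<^sub>M borel)" by (rule sets_pair_measure_cong[OF sets])
  have d1: "distr (\<pi> \<Otimes>\<^sub>M \<pi>\<^sub>0) borel fst = \<pi>"
    using B.distr_pair_fst[of \<pi>] sets by (metis distr_cong)
  have "distr (\<pi> \<Otimes>\<^sub>M \<pi>\<^sub>0) borel snd = distr (distr (\<pi>\<^sub>0 \<Otimes>\<^sub>M \<pi>) (\<pi> \<Otimes>\<^sub>M \<pi>\<^sub>0) (\<lambda>(x, y). (y, x))) borel snd"
    by (subst distr_pair_swap[symmetric]) simp
  also have "\<dots> = distr (\<pi>\<^sub>0 \<Otimes>\<^sub>M \<pi>) borel fst"
    by (subst distr_distr) (auto simp: comp_def split_beta)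
  also have "\<dots> = \<pi>\<^sub>0"
    using A.distr_pair_fst[of \<pi>\<^sub>0] sets by (metis distr_cong)
  finally have "\<pi> \<Otimes>\<^sub>M \<pi>\<^sub>0 \<in> couplings \<pi> \<pi>\<^sub>0" using sp d1 by (simp add: couplings_def)
  then have "W1 \<pi> \<pi>\<^sub>0 \<le> (\<integral>\<^sup>+ z. ennreal \<bar>fst z - snd z\<bar> \<partial>(\<pi> \<Otimes>\<^sub>M \<pi>\<^sub>0))"
    unfolding W1_def by (rule INF_lower)
  also have "\<dots> \<le> (\<integral>\<^sup>+ z. 1 \<partial>(\<pi> \<Otimes>\<^sub>M \<pi>\<^sub>0))"
  proof (rule nn_integral_mono_AE)
    have "AE x in \<pi>. x \<in> {0..1}" using e by (intro A.AE_prob_1) (simp add: measure_def)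
    then have "AE x in \<pi>. AE y in \<pi>\<^sub>0. \<bar>x - y\<bar> \<le> 1"
    proof eventually_elim
      case (elim x)
      have "AE y in \<pi>\<^sub>0. y \<in> {0..1}" using e by (intro B.AE_prob_1) (simp add: measure_def)
      then show ?case by eventually_elim (use elim in auto)
    qed
    then have "AE z in \<pi> \<Otimes>\<^sub>M \<pi>\<^sub>0. \<bar>fst z - snd z\<bar> \<le> 1"
      by (intro AE_pair_measure) auto
    then show "AE z in \<pi> \<Otimes>\<^sub>M \<pi>\<^sub>0. ennreal \<bar>fst z - snd z\<bar> \<le> 1"
      by eventually_elim (simp add: ennreal_le_1)
  qed
  also have "\<dots> = 1" by (simp add: emeasure_space_1)
  finally show ?thesis .
qed

section \<open>Finitely supported mixing distributions\<close>

text \<open>The distribution that gives mass \<open>w i\<close> to the point \<open>x i\<close>, for \<open>i\<close> in the finite index set \<open>I\<close>. The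
points need not be distinct and weights may be \<open>0\<close>, so that two distributions can be compared on a
common family of points.\<close>

definition atomic :: "nat set \<Rightarrow> (nat \<Rightarrow> real) \<Rightarrow> (nat \<Rightarrow> real) \<Rightarrow> real measure" where
  "atomic I w x = distr (point_measure I (\<lambda>i. ennreal (w i))) borel x"

lemma integral_atomic:
  fixes f :: "real \<Rightarrow> real"
  assumes "finite I" "\<And>i. i \<in> I \<Longrightarrow> 0 \<le> w i" "f \<in> borel_measurable borel"
  shows "(\<integral>y. f y \<partial>(atomic I w x)) = (\<Sum>i\<in>I. w i * f (x i))"
  unfolding atomic_def
  by (subst integral_distr) (use assms in \<open>auto simp: lebesgue_integral_point_measure_finite\<close>)

lemma atomic_in_D:
  assumes "finite I" "\<And>i. i \<in> I \<Longrightarrow> 0 \<le> w i" "(\<Sum>i\<in>I. w i) = 1" "\<And>i. i \<in> I \<Longrightarrow> x i \<in> {0..1}"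
  shows "atomic I w x \<in> D"
proof -
  have prob: "prob_space (point_measure I (\<lambda>i. ennreal (w i)))"
    using assms by (intro prob_space_point_measure) (auto simp: sum_ennreal)
  then interpret prob_space "point_measure I (\<lambda>i. ennreal (w i))" .
  have "emeasure (atomic I w x) {0..1} = emeasure (point_measure I (\<lambda>i. ennreal (w i))) (x -` {0..1} \<inter> I)"
    unfolding atomic_def by (subst emeasure_distr) (auto simp: space_point_measure)
  also have "x -` {0..1} \<inter> I = space (point_measure I (\<lambda>i. ennreal (w i)))"
    using assms(4) by (auto simp: space_point_measure)
  finally show ?thesis
    using prob by (auto simp: D_def atomic_def emeasure_space_1 intro!: prob_space_distr)
qed

text \<open>The probability that the binomial mixture over \<open>atomic I w x\<close> gives to \<open>j\<close>.\<close>

definition mixture_mass :: "nat \<Rightarrow> nat set \<Rightarrow> (nat \<Rightarrow> real) \<Rightarrow> (nat \<Rightarrow> real) \<Rightarrow> nat \<Rightarrow> real" where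
  "mixture_mass t I w x j = (\<Sum>i\<in>I. w i * (real (t choose j) * x i ^ j * (1 - x i) ^ (t - j)))"

lemma binomial_mixture_atomic:
  assumes "finite I" "\<And>i. i \<in> I \<Longrightarrow> 0 \<le> w i"
  shows "binomial_mixture t (atomic I w x) = point_measure {0..t} (\<lambda>j. ennreal (mixture_mass t I w x j))"
  unfolding binomial_mixture_def mixture_mass_def
  by (subst integral_atomic) (use assms in auto)

lemma mixture_mass_nonneg:
  assumes "\<And>i. i \<in> I \<Longrightarrow> 0 \<le> w i" "\<And>i. i \<in> I \<Longrightarrow> x i \<in> {0..1}"
  shows "0 \<le> mixture_mass t I w x j"
  unfolding mixture_mass_def using assms by (intro sum_nonneg mult_nonneg_nonneg) auto

lemma sum_mixture_mass:
  assumes "(\<Sum>i\<in>I. w i) = 1"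
  shows "(\<Sum>j\<in>{0..t}. mixture_mass t I w x j) = 1"
proof -
  have b: "(\<Sum>j\<in>{0..t}. real (t choose j) * y ^ j * (1 - y) ^ (t - j)) = 1" for y :: real
    using binomial_ring[of y "1 - y" t] by (simp add: atMost_atLeast0)
  have "(\<Sum>j\<in>{0..t}. mixture_mass t I w x j)
      = (\<Sum>i\<in>I. w i * (\<Sum>j\<in>{0..t}. real (t choose j) * x i ^ j * (1 - x i) ^ (t - j)))"
    unfolding mixture_mass_def sum_distrib_left by (rule sum.swap)
  then show ?thesis unfolding b using assms by simp
qed

section \<open>Chi-square distance of binomial mixtures around one half\<close>

text \<open>The squared norm of a signed mixture of the binomial laws with parameters \<open>1/2 + u a\<close>, in the \<open>L\<^sup>2\<close> space
of densities relative to the binomial law with parameter \<open>1/2\<close>, is a positive combination of the squared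
moments of the mixing weights. The reason is that the Gram matrix of these laws is
\<open>(1 + 4 * u a * u b) ^ t\<close>, which the binomial theorem expands into products of powers.\<close>

lemma sum_binomial_signed_mixture_squared:
  fixes s u :: "'a \<Rightarrow> real"
  shows "2 ^ t * (\<Sum>x\<le>t. (\<Sum>a\<in>A. s a * (real (t choose x) * (1/2 + u a) ^ x * (1/2 - u a) ^ (t - x)))\<^sup>2
            / real (t choose x))
       = (\<Sum>j\<le>t. real (t choose j) * 4 ^ j * (\<Sum>a\<in>A. s a * u a ^ j)\<^sup>2)"
proof -
  let ?p = "\<lambda>a. 1/2 + u a" and ?q = "\<lambda>a. 1/2 - u a"
  have kernel: "2 ^ t * (\<Sum>x\<le>t. real (t choose x) * (?p a * ?p b) ^ x * (?q a * ?q b) ^ (t - x))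
      = (\<Sum>j\<le>t. real (t choose j) * 4 ^ j * (u a ^ j * u b ^ j))" for a b
  proof -
    have "2 ^ t * (\<Sum>x\<le>t. real (t choose x) * (?p a * ?p b) ^ x * (?q a * ?q b) ^ (t - x))
        = (2 * (?p a * ?p b + ?q a * ?q b)) ^ t"
      by (simp only: binomial_ring power_mult_distrib)
    also have "2 * (?p a * ?p b + ?q a * ?q b) = 4 * (u a * u b) + 1"
      by (simp add: algebra_simps)
    also have "(4 * (u a * u b) + 1) ^ t = (\<Sum>j\<le>t. real (t choose j) * 4 ^ j * (u a ^ j * u b ^ j))"
      by (subst binomial_ring) (simp add: power_mult_distrib mult_ac)
    finally show ?thesis .
  qed
  have sq: "(\<Sum>a\<in>A. s a * (real (t choose x) * ?p a ^ x * ?q a ^ (t - x)))\<^sup>2 / real (t choose x)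
      = (\<Sum>a\<in>A. \<Sum>b\<in>A. s a * s b * (real (t choose x) * (?p a * ?p b) ^ x * (?q a * ?q b) ^ (t - x)))"
    if "x \<le> t" for x
    unfolding power2_eq_square sum_product sum_divide_distrib
    using that by (intro sum.cong) (auto simp: power_mult_distrib)
  have "2 ^ t * (\<Sum>x\<le>t. (\<Sum>a\<in>A. s a * (real (t choose x) * ?p a ^ x * ?q a ^ (t - x)))\<^sup>2 / real (t choose x))
     = 2 ^ t * (\<Sum>x\<le>t. \<Sum>a\<in>A. \<Sum>b\<in>A. s a * s b * (real (t choose x) * (?p a * ?p b) ^ x * (?q a * ?q b) ^ (t - x)))"
    using sq by simp
  also have "\<dots> = 2 ^ t * (\<Sum>a\<in>A. \<Sum>b\<in>A. \<Sum>x\<le>t. s a * s b * (real (t choose x) * (?p a * ?p b) ^ x * (?q a * ?q b) ^ (t - x)))"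
    by (subst sum.swap, subst sum.swap) (rule refl)
  also have "\<dots> = (\<Sum>a\<in>A. \<Sum>b\<in>A. s a * s b *
      (2 ^ t * (\<Sum>x\<le>t. real (t choose x) * (?p a * ?p b) ^ x * (?q a * ?q b) ^ (t - x))))"
    by (simp add: sum_distrib_left mult_ac)
  also have "\<dots> = (\<Sum>a\<in>A. \<Sum>b\<in>A. \<Sum>j\<le>t. s a * s b * (real (t choose j) * 4 ^ j * (u a ^ j * u b ^ j)))"
    by (simp only: kernel) (simp only: sum_distrib_left)
  also have "\<dots> = (\<Sum>a\<in>A. \<Sum>j\<le>t. \<Sum>b\<in>A. s a * s b * (real (t choose j) * 4 ^ j * (u a ^ j * u b ^ j)))"
    by (intro sum.cong refl sum.swap)
  also have "\<dots> = (\<Sum>j\<le>t. \<Sum>a\<in>A. \<Sum>b\<in>A. s a * s b * (real (t choose j) * 4 ^ j * (u a ^ j * u b ^ j)))"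
    by (rule sum.swap)
  also have "\<dots> = (\<Sum>j\<le>t. real (t choose j) * 4 ^ j * (\<Sum>a\<in>A. s a * u a ^ j)\<^sup>2)"
    by (simp only: power2_eq_square sum_product) (simp add: sum_distrib_left mult_ac)
  finally show ?thesis .
qed

text \<open>Mass at least \<open>1/2\<close> of the null at the parameter \<open>1/2\<close> keeps the null above half the
binomial law with parameter \<open>1/2\<close>, which accounts for the factor \<open>2\<close>.\<close>

lemma chi_square_mixture_le:
  fixes w w\<^sub>0 u :: "nat \<Rightarrow> real" and t :: nat
  assumes I: "finite I" "c \<in> I" "u c = 0" "1/2 \<le> w\<^sub>0 c" "\<And>i. i \<in> I \<Longrightarrow> 0 \<le> w\<^sub>0 i"
    and u: "\<And>i. i \<in> I \<Longrightarrow> \<bar>u i\<bar> \<le> 1/2"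
  defines "p \<equiv> mixture_mass t I w\<^sub>0 (\<lambda>i. 1/2 + u i)" and "q \<equiv> mixture_mass t I w (\<lambda>i. 1/2 + u i)"
  shows "x \<le> t \<Longrightarrow> 0 < p x"
    and "(\<Sum>x\<in>{0..t}. (q x - p x)\<^sup>2 / p x)
      \<le> 2 * (\<Sum>j\<le>t. real (t choose j) * 4 ^ j * (\<Sum>i\<in>I. (w i - w\<^sub>0 i) * u i ^ j)\<^sup>2)"
proof -
  have lower: "real (t choose x) / (2 * 2 ^ t) \<le> p x" if "x \<le> t" for x
  proof -
    have "(1/2::real) ^ x * (1/2) ^ (t - x) = 1 / 2 ^ t"
      using that by (simp add: power_one_over flip: power_add)
    then have "real (t choose x) / (2 * 2 ^ t) = 1/2 * (real (t choose x) * (1/2) ^ x * (1/2) ^ (t - x))"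
      by (simp add: mult.assoc)
    also have "\<dots> \<le> w\<^sub>0 c * (real (t choose x) * (1/2 + u c) ^ x * (1 - (1/2 + u c)) ^ (t - x))"
      using mult_right_mono[OF I(4), of "real (t choose x) * (1/2) ^ x * (1/2) ^ (t - x)"] I(3) by simp
    also have "\<dots> \<le> p x"
      unfolding p_def mixture_mass_def
    proof (rule member_le_sum[OF I(2) _ I(1)])
      fix i assume "i \<in> I - {c}"
      then have "0 \<le> w\<^sub>0 i" "\<bar>u i\<bar> \<le> 1/2" using I u by auto
      then show "0 \<le> w\<^sub>0 i * (real (t choose x) * (1/2 + u i) ^ x * (1 - (1/2 + u i)) ^ (t - x))"
        by (intro mult_nonneg_nonneg zero_le_power) auto
    qed
    finally show ?thesis .
  qed
  have pos: "0 < real (t choose x) / (2 * 2 ^ t)" if "x \<le> t" for x using that by simp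
  have diff: "q x - p x = (\<Sum>i\<in>I. (w i - w\<^sub>0 i) * (real (t choose x) * (1/2 + u i) ^ x * (1/2 - u i) ^ (t - x)))" for x
    unfolding p_def q_def mixture_mass_def sum_subtractf[symmetric]
    by (intro sum.cong) (auto simp: left_diff_distrib)
  have ppos: "0 < p x" if "x \<le> t" for x using lower[OF that] pos[OF that] by linarith
  then show "0 < p x" if "x \<le> t" for x using that .
  have "(\<Sum>x\<in>{0..t}. (q x - p x)\<^sup>2 / p x) \<le> (\<Sum>x\<in>{0..t}. (q x - p x)\<^sup>2 / (real (t choose x) / (2 * 2 ^ t)))"
    by (intro sum_mono divide_left_mono mult_pos_pos)
       (use lower pos ppos in auto)
  also have "\<dots> = 2 * (2 ^ t * (\<Sum>x\<le>t. (q x - p x)\<^sup>2 / real (t choose x)))"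
    by (simp add: sum_distrib_left atMost_atLeast0 mult_ac)
  also have "\<dots> = 2 * (\<Sum>j\<le>t. real (t choose j) * 4 ^ j * (\<Sum>i\<in>I. (w i - w\<^sub>0 i) * u i ^ j)\<^sup>2)"
    unfolding diff by (simp only: sum_binomial_signed_mixture_squared)
  finally show "(\<Sum>x\<in>{0..t}. (q x - p x)\<^sup>2 / p x)
      \<le> 2 * (\<Sum>j\<le>t. real (t choose j) * 4 ^ j * (\<Sum>i\<in>I. (w i - w\<^sub>0 i) * u i ^ j)\<^sup>2)" .
qed

text \<open>A Chernoff bound: as only the indices \<open>j \<ge> N\<close> contribute, each term may be multiplied by
\<open>exp (2 * (j - N)) \<ge> 1\<close>, after which the binomial theorem evaluates the sum.\<close>

lemma binomial_moment_sum_tail: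
  fixes m :: "nat \<Rightarrow> real"
  assumes "\<And>j. j < N \<Longrightarrow> m j = 0" "\<And>j. \<bar>m j\<bar> \<le> \<delta> ^ j"
  shows "(\<Sum>j\<le>t. real (t choose j) * 4 ^ j * (m j)\<^sup>2) \<le> exp (4 * exp 2 * \<delta>\<^sup>2 * real t - 2 * real N)"
proof -
  have "(\<Sum>j\<le>t. real (t choose j) * 4 ^ j * (m j)\<^sup>2)
      \<le> (\<Sum>j\<le>t. exp (- 2 * real N) * (real (t choose j) * (4 * exp 2 * \<delta>\<^sup>2) ^ j))"
  proof (rule sum_mono)
    fix j
    have "(m j)\<^sup>2 \<le> exp (- 2 * real N) * (exp 2 * \<delta>\<^sup>2) ^ j"
    proof (cases "j < N")
      case True
      then show ?thesis using assms(1) by simp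
    next
      case False
      have "(m j)\<^sup>2 \<le> (\<delta> ^ j)\<^sup>2" using power_mono[OF assms(2)[of j], of 2] by simp
      also have "\<dots> \<le> exp (- 2 * real N + 2 * real j) * (\<delta> ^ j)\<^sup>2"
        using False by (intro mult_le_cancel_right1[THEN iffD2]) auto
      also have "\<dots> = exp (- 2 * real N) * (exp 2 * \<delta>\<^sup>2) ^ j"
        unfolding exp_add power_mult_distrib
        by (simp add: mult.commute flip: exp_of_nat_mult power_mult)
      finally show ?thesis .
    qed
    then have "real (t choose j) * 4 ^ j * (m j)\<^sup>2 \<le> real (t choose j) * 4 ^ j * (exp (- 2 * real N) * (exp 2 * \<delta>\<^sup>2) ^ j)"
      by (intro mult_left_mono) auto
    then show "real (t choose j) * 4 ^ j * (m j)\<^sup>2 \<le> exp (- 2 * real N) * (real (t choose j) * (4 * exp 2 * \<delta>\<^sup>2) ^ j)"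
      by (simp add: power_mult_distrib mult_ac)
  qed
  also have "\<dots> = exp (- 2 * real N) * (4 * exp 2 * \<delta>\<^sup>2 + 1) ^ t"
    by (simp add: sum_distrib_left binomial_ring)
  also have "\<dots> \<le> exp (- 2 * real N) * exp (4 * exp 2 * \<delta>\<^sup>2) ^ t"
    using exp_ge_add_one_self[of "4 * exp 2 * \<delta>\<^sup>2"]
    by (intro mult_left_mono power_mono) (auto simp: add.commute)
  also have "\<dots> = exp (4 * exp 2 * \<delta>\<^sup>2 * real t - 2 * real N)"
    unfolding exp_of_nat2_mult[symmetric] exp_add[symmetric] by (simp add: algebra_simps)
  finally show ?thesis .
qed

section \<open>Alternating sums over Chebyshev nodes\<close>

lemma sum_cos_full_period:
  assumes "0 < m" "m < 2 * N"
  shows "(\<Sum>k<2*N. cos (real m * (real k * pi / real N))) = 0"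
proof -
  define h where "h = real m * pi / (2 * real N)"
  have N: "N > 0" using assms by auto
  have "0 < h" "h < pi" using assms by (auto simp: h_def field_simps)
  then have sh: "sin h > 0" by (rule sin_gt_zero)
  have step: "2 * sin h * cos (real m * (real k * pi / real N))
      = sin (2 * real (Suc k) * h - h) - sin (2 * real k * h - h)" for k
  proof -
    have a: "real m * (real k * pi / real N) = 2 * real k * h" using N by (simp add: h_def field_simps)
    show ?thesis unfolding a
      using sin_add[of "2 * real k * h" h] sin_diff[of "2 * real k * h" h]
      by (simp add: algebra_simps)
  qed
  have "2 * sin h * (\<Sum>k<2*N. cos (real m * (real k * pi / real N)))
      = (\<Sum>k<2*N. sin (2 * real (Suc k) * h - h) - sin (2 * real k * h - h))"
    by (simp only: sum_distrib_left step)
  also have "\<dots> = sin (2 * real (2*N) * h - h) - sin (- h)"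
    by (subst sum_lessThan_telescope) simp
  also have "2 * real (2*N) * h - h = - h + 2 * real m * pi"
    using N by (simp add: h_def field_simps)
  also have "sin (- h + 2 * real m * pi) = sin (- h)"
    by (simp only: sin_add sin_2npi cos_2npi)
  finally show ?thesis using sh by simp
qed

text \<open>The sign \<open>(-1) ^ k\<close> is \<open>cos (k * pi)\<close>, which shifts the frequency by \<open>N\<close> into the range where the sum
over the full period vanishes.\<close>

lemma sum_alternating_cos:
  fixes l :: int
  assumes "\<bar>l\<bar> < int N"
  shows "(\<Sum>k<2*N. (-1) ^ k * cos (of_int l * (real k * pi / real N))) = 0"
proof -
  define m where "m = nat (l + int N)"
  have m: "0 < m" "m < 2 * N" and rm: "real m = of_int l + real N" using assms by (auto simp: m_def)
  have "(-1) ^ k * cos (of_int l * (real k * pi / real N)) = cos (real m * (real k * pi / real N))" for k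
  proof -
    have "real m * (real k * pi / real N) = of_int l * (real k * pi / real N) + real k * pi"
      using assms by (simp add: rm field_simps)
    then show ?thesis by (simp add: cos_add)
  qed
  then show ?thesis using sum_cos_full_period[OF m] by simp
qed

text \<open>The extra factor \<open>cos (l * \<theta>)\<close> makes the induction on \<open>j\<close> work: one factor \<open>cos \<theta>\<close> turns it into frequencies
\<open>l + 1\<close> and \<open>l - 1\<close>.\<close>

lemma sum_alternating_cos_power_cos:
  fixes l :: int
  assumes "int j + \<bar>l\<bar> < int N"
  shows "(\<Sum>k<2*N. (-1) ^ k * (cos (real k * pi / real N) ^ j * cos (of_int l * (real k * pi / real N)))) = 0"
  using assms
proof (induction j arbitrary: l)
  case 0
  then show ?case using sum_alternating_cos[of l N] by simp
next
  case (Suc j)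
  have prod: "cos x ^ Suc j * cos (of_int l * x)
      = (cos x ^ j * cos (of_int (l + 1) * x) + cos x ^ j * cos (of_int (l - 1) * x)) / 2" for x :: real
    by (simp add: distrib_right left_diff_distrib cos_add cos_diff algebra_simps)
  have "(\<Sum>k<2*N. (-1) ^ k * (cos (real k * pi / real N) ^ Suc j * cos (of_int l * (real k * pi / real N))))
    = ((\<Sum>k<2*N. (-1) ^ k * (cos (real k * pi / real N) ^ j * cos (of_int (l + 1) * (real k * pi / real N))))
     + (\<Sum>k<2*N. (-1) ^ k * (cos (real k * pi / real N) ^ j * cos (of_int (l - 1) * (real k * pi / real N))))) / 2"
    unfolding prod by (simp add: sum_divide_distrib sum.distrib[symmetric] distrib_left add_divide_distrib)
  also have "\<dots> = 0"
    using Suc.prems by (subst (1 2) Suc.IH) auto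
  finally show ?case .
qed

corollary sum_alternating_cos_power:
  assumes "j < N"
  shows "(\<Sum>k<2*N. (-1) ^ k * cos (real k * pi / real N) ^ j) = 0"
  using sum_alternating_cos_power_cos[of j 0 N] assms by simp

lemma sum_sin_squared:
  assumes "2 \<le> N"
  shows "(\<Sum>k<2*N. (sin (real k * pi / real N))\<^sup>2) = real N"
proof -
  have "(\<Sum>k<2*N. (sin (real k * pi / real N))\<^sup>2)
      = (\<Sum>k<2*N. 1/2 - cos (real 2 * (real k * pi / real N)) / 2)"
    by (rule sum.cong) (auto simp only: of_nat_numeral cos_double_sin, auto simp: field_simps)
  also have "\<dots> = real N - (\<Sum>k<2*N. cos (real 2 * (real k * pi / real N))) / 2"
    by (simp only: sum_subtractf sum_divide_distrib) simp
  also have "\<dots> = real N" using assms by (subst sum_cos_full_period) auto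
  finally show ?thesis .
qed

text \<open>The product of \<open>1 - y\<^sup>2\<close> with the Chebyshev polynomial of degree \<open>N\<close>, meaningful for
\<open>-1 \<le> y \<le> 1\<close>. The Chebyshev polynomial itself has slopes of order \<open>N\<^sup>2\<close> at the end points of the
interval; the factor \<open>1 - y\<^sup>2\<close> brings the Lipschitz constant down to order \<open>N\<close>.\<close>

definition cheb_bump :: "nat \<Rightarrow> real \<Rightarrow> real" where
  "cheb_bump N y = (1 - y\<^sup>2) * cos (real N * arccos y)"

lemma cos_multiple_cong:
  fixes a b :: real
  assumes "cos a = cos b"
  shows "cos (real n * a) = cos (real n * b)"
proof (induction n rule: induct_nat_012)
  case (ge2 n)
  have rec: "cos (real (Suc (Suc n)) * x) = 2 * cos x * cos (real (Suc n) * x) - cos (real n * x)" for x :: real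
    using cos_add[of "real (Suc n) * x" x] cos_diff[of "real (Suc n) * x" x]
    by (simp add: algebra_simps)
  show ?case unfolding rec using ge2 assms by simp
qed (use assms in auto)

lemma cheb_bump_cos:
  "cheb_bump N (cos x) = (sin x)\<^sup>2 * cos (real N * x)"
proof -
  have "cos (arccos (cos x)) = cos x" by (rule cos_arccos) auto
  then have "cos (real N * arccos (cos x)) = cos (real N * x)" by (rule cos_multiple_cong)
  then show ?thesis by (simp add: cheb_bump_def sin_squared_eq)
qed

lemma cheb_bump_lipschitz:
  assumes "x \<in> {-1..1}" "y \<in> {-1..1}"
  shows "\<bar>cheb_bump N x - cheb_bump N y\<bar> \<le> (real N + 2) * \<bar>x - y\<bar>"
proof -
  have main: "\<bar>cheb_bump N b - cheb_bump N a\<bar> \<le> (real N + 2) * \<bar>b - a\<bar>"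
    if ab: "a < b" "-1 \<le> a" "b \<le> 1" for a b
  proof -
    have der: "(cheb_bump N has_real_derivative
        (- 2 * z * cos (real N * arccos z) + real N * sqrt (1 - z\<^sup>2) * sin (real N * arccos z))) (at z)"
      if z: "a < z" "z < b" for z
    proof -
      have zz: "-1 < z" "z < 1" using z ab by auto
      then have p: "0 < 1 - z\<^sup>2" by (simp add: abs_square_less_1)
      have s: "(1 - z\<^sup>2) / sqrt (1 - z\<^sup>2) = sqrt (1 - z\<^sup>2)" using p by (simp add: real_div_sqrt)
      have "((\<lambda>y. (1 - y\<^sup>2) * cos (real N * arccos y)) has_real_derivative
         - (2 * z) * cos (real N * arccos z)
          + (1 - z\<^sup>2) * (- sin (real N * arccos z) * (real N * inverse (- sqrt (1 - z\<^sup>2))))) (at z)"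
        using zz by (auto intro!: derivative_eq_intros)
      also have "(1 - z\<^sup>2) * (- sin (real N * arccos z) * (real N * inverse (- sqrt (1 - z\<^sup>2))))
          = real N * ((1 - z\<^sup>2) / sqrt (1 - z\<^sup>2)) * sin (real N * arccos z)"
        by (simp add: divide_inverse)
      finally show ?thesis unfolding s cheb_bump_def[abs_def] by simp
    qed
    have "continuous_on {a..b} (cheb_bump N)"
      unfolding cheb_bump_def[abs_def] using ab by (intro continuous_intros) auto
    then obtain l z where z: "a < z" "z < b" and l: "DERIV (cheb_bump N) z :> l"
      and eq: "cheb_bump N b - cheb_bump N a = (b - a) * l"
      using MVT[OF ab(1)] der real_differentiable_def by metis
    have "l = - 2 * z * cos (real N * arccos z) + real N * sqrt (1 - z\<^sup>2) * sin (real N * arccos z)"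
      using DERIV_unique[OF l der[OF z]] .
    then have "\<bar>l\<bar> \<le> \<bar>2 * z * cos (real N * arccos z)\<bar> + \<bar>real N * sqrt (1 - z\<^sup>2) * sin (real N * arccos z)\<bar>"
      by linarith
    also have "\<dots> \<le> 2 * 1 * 1 + real N * 1 * 1"
      using z ab unfolding abs_mult
      by (intro add_mono mult_mono) (auto simp: abs_square_le_1)
    finally have "\<bar>l\<bar> \<le> real N + 2" by simp
    then show ?thesis
      using ab by (simp add: eq abs_mult mult.commute mult_left_mono)
  qed
  show ?thesis
    using main[of x y] main[of y x] assms
    by (cases x y rule: linorder_cases) (auto simp: abs_minus_commute)
qed

section \<open>From a pair of priors to the critical separation\<close>

text \<open>The reduction to a single alternative. As the infimum of the empty set of reals is unspecified, the
set of achievable separations has to be nonempty: it contains \<open>2\<close>, as no distribution is that far from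
the null and the test that always accepts is valid.\<close>

lemma critical_separation_ge:
  assumes \<alpha>: "0 \<le> \<alpha>" and \<beta>: "0 \<le> \<beta>"
    and \<pi>: "\<pi>\<^sub>0 \<in> D" "\<pi> \<in> D" "ennreal d \<le> W1 \<pi> \<pi>\<^sub>0"
    and acc: "\<And>\<psi>. \<psi> \<in> valid_tests \<alpha> n t \<pi>\<^sub>0 \<Longrightarrow> ennreal r \<le> accept_prob n t \<pi> \<psi>"
    and r: "\<beta> < r"
  shows "critical_separation \<alpha> \<beta> n t \<ge> d"
  unfolding critical_separation_def
proof (rule cInf_greatest)
  have "global_risk \<alpha> n t 2 \<le> 0"
    unfolding global_risk_def
  proof (rule SUP_least)
    fix \<mu> assume \<mu>: "\<mu> \<in> D"
    have "\<not> ennreal 2 \<le> W1 \<nu> \<mu>" if "\<nu> \<in> D" for \<nu>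
      using order_trans[OF _ W1_le_1[OF that \<mu>], of "ennreal 2"] by (auto simp: ennreal_le_1)
    then have none: "{\<nu> \<in> D. W1 \<nu> \<mu> \<ge> ennreal 2} = {}" by auto
    have "(\<lambda>_. 0) \<in> valid_tests \<alpha> n t \<mu>"
      by (simp add: valid_tests_def tests_def reject_prob_def)
    then show "local_risk \<alpha> n t 2 \<mu> \<le> 0"
      unfolding local_risk_def none by (rule INF_lower2) (simp add: bot_ennreal)
  qed
  then show "{\<epsilon>. global_risk \<alpha> n t \<epsilon> \<le> ennreal \<beta>} \<noteq> {}"
    by (auto intro!: exI[of _ 2])
next
  fix \<epsilon> assume "\<epsilon> \<in> {\<epsilon>. global_risk \<alpha> n t \<epsilon> \<le> ennreal \<beta>}"
  then have glob: "global_risk \<alpha> n t \<epsilon> \<le> ennreal \<beta>" by simp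
  show "d \<le> \<epsilon>"
  proof (rule ccontr)
    assume "\<not> d \<le> \<epsilon>"
    then have "ennreal \<epsilon> \<le> ennreal d" by (intro ennreal_leI) simp
    then have mem: "\<pi> \<in> {\<pi> \<in> D. W1 \<pi> \<pi>\<^sub>0 \<ge> ennreal \<epsilon>}" using \<pi> by auto
    have "ennreal r \<le> local_risk \<alpha> n t \<epsilon> \<pi>\<^sub>0"
      unfolding local_risk_def using mem acc by (intro INF_greatest SUP_upper2)
    also have "\<dots> \<le> global_risk \<alpha> n t \<epsilon>"
      unfolding global_risk_def using \<pi> by (intro SUP_upper)
    also note glob
    finally show False using r \<beta> by (simp add: ennreal_le_iff)
  qed
qed

text \<open>A divergence of at most \<open>c / n\<close> per observation gives \<open>(1 + c / n) ^ n \<le> exp c \<le> 1 + \<eta>\<^sup>2\<close>, so that the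
acceptance probability decreases by at most \<open>\<eta>\<close>.\<close>

lemma critical_separation_ge_atomic:
  assumes \<alpha>: "0 \<le> \<alpha>" and \<beta>: "0 \<le> \<beta>" and \<eta>: "0 \<le> \<eta>" "\<beta> < 1 - \<alpha> - \<eta>" and n: "0 < n"
    and I: "finite I" "\<And>i. i \<in> I \<Longrightarrow> x i \<in> {0..1}"
    and w0: "\<And>i. i \<in> I \<Longrightarrow> 0 \<le> w\<^sub>0 i" "(\<Sum>i\<in>I. w\<^sub>0 i) = 1"
    and w: "\<And>i. i \<in> I \<Longrightarrow> 0 \<le> w i" "(\<Sum>i\<in>I. w i) = 1"
    and ac: "\<And>j. j \<le> t \<Longrightarrow> mixture_mass t I w\<^sub>0 x j = 0 \<Longrightarrow> mixture_mass t I w x j = 0"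
    and chi: "(\<Sum>j\<in>{0..t}. (mixture_mass t I w x j - mixture_mass t I w\<^sub>0 x j)\<^sup>2 / mixture_mass t I w\<^sub>0 x j)
        \<le> c / real n"
    and c: "0 \<le> c" "c \<le> ln (1 + \<eta>\<^sup>2)"
    and W: "ennreal d \<le> W1 (atomic I w x) (atomic I w\<^sub>0 x)"
  shows "critical_separation \<alpha> \<beta> n t \<ge> d"
proof (rule critical_separation_ge[OF \<alpha> \<beta> _ _ W _ \<eta>(2)])
  show "atomic I w\<^sub>0 x \<in> D" "atomic I w x \<in> D" using I w0 w by (auto intro!: atomic_in_D)
  fix \<psi> assume \<psi>: "\<psi> \<in> valid_tests \<alpha> n t (atomic I w\<^sub>0 x)"
  have "(1 + c / real n) ^ n \<le> exp (c / real n) ^ n"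
    using c n by (intro power_mono) auto
  also have "\<dots> = exp c" using n by (simp flip: exp_of_nat_mult)
  also have "\<dots> \<le> exp (ln (1 + \<eta>\<^sup>2))" using c by simp
  also have "\<dots> = 1 + \<eta>\<^sup>2" by (intro exp_ln) (simp add: add_pos_nonneg)
  finally have "sqrt ((1 + c / real n) ^ n - 1) \<le> sqrt (\<eta>\<^sup>2)" by (intro real_sqrt_le_mono) simp
  then have "1 - \<alpha> - \<eta> \<le> 1 - \<alpha> - sqrt ((1 + c / real n) ^ n - 1)" using \<eta> by simp
  then have "ennreal (1 - \<alpha> - \<eta>) \<le> ennreal (1 - \<alpha> - sqrt ((1 + c / real n) ^ n - 1))"
    by (rule ennreal_leI)
  also have "\<dots> \<le> accept_prob n t (atomic I w x) \<psi>"
    using I w0 w ac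
    by (intro accept_prob_ge_chi_square[OF binomial_mixture_atomic binomial_mixture_atomic _ _ _ _ _ chi \<psi> \<alpha>]
        sum_mixture_mass mixture_mass_nonneg) auto
  finally show "ennreal (1 - \<alpha> - \<eta>) \<le> accept_prob n t (atomic I w x) \<psi>" .
qed

section \<open>The Chebyshev pair of priors\<close>

text \<open>The points of the Chebyshev pair are \<open>1/2 + cheb_offset N \<delta> k\<close> for \<open>k \<le> 2 * N\<close>. The indices
\<open>k < 2 * N\<close> run through a full period of the angle, so that the points other than \<open>1/2 + \<delta>\<close> and
\<open>1/2 - \<delta>\<close> are listed twice; the last index \<open>2 * N\<close> is reserved for the common atom at \<open>1/2\<close>.\<close>

definition cheb_offset :: "nat \<Rightarrow> real \<Rightarrow> nat \<Rightarrow> real" where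
  "cheb_offset N \<delta> k = (if k < 2 * N then \<delta> * cos (real k * pi / real N) else 0)"

text \<open>The weights: \<open>s = 1\<close> selects the even nodes and \<open>s = -1\<close> the odd ones, with total mass \<open>1/2\<close>; the other
half of the mass is at the common atom.\<close>

definition cheb_weight :: "nat \<Rightarrow> real \<Rightarrow> nat \<Rightarrow> real" where
  "cheb_weight N s k = (if k < 2 * N then (1 + s * (-1) ^ k) / (4 * real N) else 1 / 2)"

lemma abs_cheb_offset_le:
  assumes "0 \<le> \<delta>"
  shows "\<bar>cheb_offset N \<delta> k\<bar> \<le> \<delta>"
  using assms mult_left_le[of "\<bar>cos (real k * pi / real N)\<bar>" \<delta>]
  by (simp add: cheb_offset_def abs_mult)

lemma cheb_weight_nonneg: "\<bar>s\<bar> \<le> 1 \<Longrightarrow> 0 \<le> cheb_weight N s k"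
  by (cases "even k") (auto simp: cheb_weight_def)

lemma sum_atMost_double_split:
  fixes f :: "nat \<Rightarrow> real"
  shows "(\<Sum>k\<in>{..2*N}. f k) = (\<Sum>k<2*N. f k) + f (2*N)"
  by (simp flip: lessThan_Suc_atMost)

lemma sum_cheb_weight:
  assumes "0 < N"
  shows "(\<Sum>k\<in>{..2*N}. cheb_weight N s k) = 1"
proof -
  have "(\<Sum>k\<in>{..2*N}. cheb_weight N s k)
      = (\<Sum>k<2*N. 1 / (4 * real N) + s / (4 * real N) * (-1) ^ k) + 1/2"
    unfolding sum_atMost_double_split by (simp add: cheb_weight_def add_divide_distrib)
  also have "\<dots> = 1/2 + s / (4 * real N) * (\<Sum>k<2*N. (-1) ^ k) + 1/2"
    using assms by (simp add: sum.distrib sum_distrib_left)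
  also have "(\<Sum>k<2*N. (-1) ^ k :: real) = 0"
    using sum_alternating_cos_power[of 0 N] assms by simp
  finally show ?thesis by simp
qed

lemma cheb_weight_diff:
  "cheb_weight N 1 k - cheb_weight N (-1) k = (if k < 2 * N then (-1) ^ k / (2 * real N) else 0)"
  by (cases "even k") (auto simp: cheb_weight_def field_simps)

lemma sum_cheb_weight_diff:
  "(\<Sum>k\<in>{..2*N}. (cheb_weight N 1 k - cheb_weight N (-1) k) * g k)
    = (\<Sum>k<2*N. (-1) ^ k * g k) / (2 * real N)"
  unfolding sum_atMost_double_split by (simp add: cheb_weight_diff sum_divide_distrib)

lemma cheb_moment_diff:
  fixes N :: nat and \<delta> :: real
  assumes "0 \<le> \<delta>"
  defines "m \<equiv> \<lambda>j. \<Sum>k\<in>{..2*N}. (cheb_weight N 1 k - cheb_weight N (-1) k) * cheb_offset N \<delta> k ^ j"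
  shows "j < N \<Longrightarrow> m j = 0" and "\<bar>m j\<bar> \<le> \<delta> ^ j"
proof -
  have eq: "m j = \<delta> ^ j * ((\<Sum>k<2*N. (-1) ^ k * cos (real k * pi / real N) ^ j) / (2 * real N))" for j
  proof -
    have "(\<Sum>k<2*N. (-1) ^ k * cheb_offset N \<delta> k ^ j)
        = \<delta> ^ j * (\<Sum>k<2*N. (-1) ^ k * cos (real k * pi / real N) ^ j)"
      unfolding sum_distrib_left
      by (intro sum.cong) (auto simp: cheb_offset_def power_mult_distrib)
    then show ?thesis unfolding m_def sum_cheb_weight_diff by simp
  qed
  show "m j = 0" if "j < N" unfolding eq using sum_alternating_cos_power[OF that] by simp
  have "\<bar>\<Sum>k<2*N. (-1) ^ k * cos (real k * pi / real N) ^ j\<bar> \<le> (\<Sum>k<2*N. 1)"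
    by (rule order_trans[OF sum_abs]) (intro sum_mono, simp add: abs_mult power_abs power_le_one)
  then have *: "\<bar>(\<Sum>k<2*N. (-1) ^ k * cos (real k * pi / real N) ^ j) / (2 * real N)\<bar> \<le> 1"
    by (cases "N = 0") (auto simp: divide_le_eq)
  show "\<bar>m j\<bar> \<le> \<delta> ^ j"
    using mult_left_le[OF *, of "\<delta> ^ j"] assms(1) by (simp add: eq abs_mult)
qed

lemma W1_cheb_ge:
  assumes \<delta>: "0 < \<delta>" "\<delta> \<le> 1/2" and N: "2 \<le> N"
  shows "W1 (atomic {..2*N} (cheb_weight N 1) (\<lambda>k. 1/2 + cheb_offset N \<delta> k))
            (atomic {..2*N} (cheb_weight N (-1)) (\<lambda>k. 1/2 + cheb_offset N \<delta> k))
          \<ge> ennreal (\<delta> / (2 * (real N + 2)))" (is "W1 ?\<mu> ?\<nu> \<ge> _")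
proof -
  \<comment> \<open>The Lipschitz bound on \<open>cheb_bump\<close> holds on \<open>[-1, 1]\<close> only; clamping the rescaled argument makes it
    global.\<close>
  define clamp where "clamp x = max (-1) (min 1 ((x - 1/2) / \<delta>))" for x :: real
  define f where "f x = cheb_bump N (clamp x)" for x
  have loc: "1/2 + cheb_offset N \<delta> k \<in> {0..1}" for k
    using abs_cheb_offset_le[of \<delta> N k] \<delta> unfolding atLeastAtMost_iff by linarith
  have D: "?\<mu> \<in> D" "?\<nu> \<in> D"
    using N loc by (auto intro!: atomic_in_D cheb_weight_nonneg sum_cheb_weight)
  have clamp: "clamp x \<in> {-1..1}" for x by (auto simp: clamp_def)
  have lip: "\<bar>f x - f y\<bar> \<le> (real N + 2) / \<delta> * \<bar>x - y\<bar>" for x y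
  proof -
    have "\<bar>f x - f y\<bar> \<le> (real N + 2) * \<bar>clamp x - clamp y\<bar>"
      unfolding f_def by (intro cheb_bump_lipschitz clamp)
    also have "\<bar>clamp x - clamp y\<bar> \<le> \<bar>(x - 1/2) / \<delta> - (y - 1/2) / \<delta>\<bar>"
      unfolding clamp_def by linarith
    also have "\<dots> = \<bar>x - y\<bar> / \<delta>" using \<delta> by (simp add: abs_divide flip: diff_divide_distrib)
    finally show ?thesis by (simp add: mult_left_mono)
  qed
  have bd: "\<bar>f x\<bar> \<le> 1" for x
  proof -
    have "\<bar>1 - (clamp x)\<^sup>2\<bar> * \<bar>cos (real N * arccos (clamp x))\<bar> \<le> 1 * 1"
      using clamp[of x] by (intro mult_mono) (auto simp: abs_square_le_1)
    then show ?thesis by (simp add: f_def cheb_bump_def abs_mult)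
  qed
  have fk: "f (1/2 + cheb_offset N \<delta> k) = (-1) ^ k * (sin (real k * pi / real N))\<^sup>2" if "k < 2 * N" for k
  proof -
    have "clamp (1/2 + cheb_offset N \<delta> k) = cos (real k * pi / real N)"
      using that \<delta> by (simp add: clamp_def cheb_offset_def)
    then show ?thesis using N by (simp add: f_def cheb_bump_cos)
  qed
  have "continuous_on UNIV f"
    using lip \<delta> by (intro lipschitz_on_continuous_on[of "(real N + 2) / \<delta>"]) (auto simp: lipschitz_on_def dist_real_def)
  then have [measurable]: "f \<in> borel_measurable borel" by (rule borel_measurable_continuous_onI)
  have "(\<integral>x. f x \<partial>?\<mu>) - (\<integral>x. f x \<partial>?\<nu>)
      = (\<Sum>k\<in>{..2*N}. (cheb_weight N 1 k - cheb_weight N (-1) k) * f (1/2 + cheb_offset N \<delta> k))"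
    by (simp add: integral_atomic cheb_weight_nonneg left_diff_distrib sum_subtractf)
  also have "\<dots> = (\<Sum>k<2*N. (sin (real k * pi / real N))\<^sup>2) / (2 * real N)"
    unfolding sum_cheb_weight_diff
    by (intro arg_cong2[where f = "(/)"] sum.cong refl) (simp add: fk flip: power_add mult.assoc)
  also have "\<dots> = 1/2" using N sum_sin_squared[OF N] by simp
  finally have gap: "(\<integral>x. f x \<partial>?\<mu>) - (\<integral>x. f x \<partial>?\<nu>) = 1/2" .
  show ?thesis
  proof (rule W1_ge_of_lipschitz[OF D _ lip bd])
    show "(real N + 2) / \<delta> * (\<delta> / (2 * (real N + 2))) \<le> (\<integral>x. f x \<partial>?\<mu>) - (\<integral>x. f x \<partial>?\<nu>)"
      unfolding gap using \<delta> by (simp add: field_simps)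
  qed (use \<delta> in auto)
qed

text \<open>If \<open>t < N\<close>, all moments that a binomial law with \<open>t\<close> trials can see agree, and the divergence is \<open>0\<close>.\<close>

lemma critical_separation_ge_cheb:
  assumes \<alpha>: "0 \<le> \<alpha>" and \<beta>: "0 \<le> \<beta>" and \<eta>: "0 \<le> \<eta>" "\<beta> < 1 - \<alpha> - \<eta>" and n: "0 < n"
    and c: "0 \<le> c" "c \<le> ln (1 + \<eta>\<^sup>2)"
    and \<delta>: "0 < \<delta>" "\<delta> \<le> 1/2" and N: "2 \<le> N"
    and or: "t < N \<or> 2 * exp (4 * exp 2 * \<delta>\<^sup>2 * real t - 2 * real N) \<le> c / real n"
  shows "critical_separation \<alpha> \<beta> n t \<ge> \<delta> / (2 * (real N + 2))"
proof -
  let ?u = "cheb_offset N \<delta>" and ?I = "{..2*N}"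
  define m where "m j = (\<Sum>k\<in>?I. (cheb_weight N 1 k - cheb_weight N (-1) k) * ?u k ^ j)" for j
  have m: "j < N \<Longrightarrow> m j = 0" "\<bar>m j\<bar> \<le> \<delta> ^ j" for j
    using cheb_moment_diff[where \<delta> = \<delta> and N = N and j = j] \<delta> by (auto simp: m_def)
  have u: "\<bar>?u k\<bar> \<le> 1/2" for k
    using abs_cheb_offset_le[of \<delta> N k] \<delta> by linarith
  have moments: "2 * (\<Sum>j\<le>t. real (t choose j) * 4 ^ j * (m j)\<^sup>2) \<le> c / real n"
    using or
  proof
    assume "t < N"
    then have "(\<Sum>j\<le>t. real (t choose j) * 4 ^ j * (m j)\<^sup>2) = 0" using m(1) by (intro sum.neutral) auto
    then show ?thesis using c by simp
  next
    assume "2 * exp (4 * exp 2 * \<delta>\<^sup>2 * real t - 2 * real N) \<le> c / real n"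
    then show ?thesis using binomial_moment_sum_tail[of N m \<delta> t, OF m] by linarith
  qed
  note chi = chi_square_mixture_le[of ?I "2*N" ?u "cheb_weight N (-1)"]
  show ?thesis
  proof (rule critical_separation_ge_atomic[OF \<alpha> \<beta> \<eta> n _ _ _ _ _ _ _ _ c W1_cheb_ge[OF \<delta> N]])
    show "1/2 + ?u k \<in> {0..1}" for k using u[of k] unfolding atLeastAtMost_iff by linarith
    show "0 \<le> cheb_weight N 1 k" "0 \<le> cheb_weight N (-1) k" for k by (simp_all add: cheb_weight_nonneg)
    show "sum (cheb_weight N 1) ?I = 1" "sum (cheb_weight N (-1)) ?I = 1"
      using N by (simp_all add: sum_cheb_weight del: sum.atMost_Suc)
    have centre: "?u (2*N) = 0" "1/2 \<le> cheb_weight N (-1) (2*N)"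
      by (simp_all add: cheb_offset_def cheb_weight_def)
    let ?p = "mixture_mass t ?I (cheb_weight N (-1)) (\<lambda>i. 1/2 + ?u i)"
      and ?q = "mixture_mass t ?I (cheb_weight N 1) (\<lambda>i. 1/2 + ?u i)"
    have "0 < ?p j" if "j \<le> t" for j
      by (rule chi(1)[OF _ _ centre _ u that]) (simp_all add: cheb_weight_nonneg)
    then show "?q j = 0" if "j \<le> t" "?p j = 0" for j using that by fastforce
    have "(\<Sum>j\<in>{0..t}. (?q j - ?p j)\<^sup>2 / ?p j) \<le> 2 * (\<Sum>j\<le>t. real (t choose j) * 4 ^ j * (m j)\<^sup>2)"
      unfolding m_def by (rule chi(2)[OF _ _ centre _ u]) (simp_all add: cheb_weight_nonneg)
    with moments show "(\<Sum>j\<in>{0..t}. (?q j - ?p j)\<^sup>2 / ?p j) \<le> c / real n" by linarith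
  qed simp
qed

section \<open>The three lower bounds\<close>

lemma mixture_mass_two_point:
  assumes "1 \<le> t" "j \<le> t"
  shows "mixture_mass t {..1} w real j = (if j = 0 then w 0 else 0) + (if j = t then w 1 else 0)"
  using assms by (auto simp: mixture_mass_def power_0_left)

lemma critical_separation_ge_two_point:
  assumes \<alpha>: "0 \<le> \<alpha>" and \<beta>: "0 \<le> \<beta>" and \<eta>: "0 \<le> \<eta>" "\<beta> < 1 - \<alpha> - \<eta>" and n: "0 < n"
    and c: "0 \<le> c" "c \<le> 1" "c \<le> ln (1 + \<eta>\<^sup>2)" and t: "1 \<le> t"
  shows "critical_separation \<alpha> \<beta> n t \<ge> sqrt c / 2 * (1 / sqrt (real n))"
proof -
  define h where "h = sqrt c / 2 * (1 / sqrt (real n))"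
  define w\<^sub>0 w :: "nat \<Rightarrow> real" where "w\<^sub>0 i = 1/2" and "w i = (if i = 0 then 1/2 - h else 1/2 + h)" for i
  have h2: "4 * h\<^sup>2 = c / real n"
    using c n by (simp add: h_def power_mult_distrib power_divide)
  have h0: "0 \<le> h" using c by (simp add: h_def)
  have "c / real n \<le> 1" using c n by (simp add: divide_le_eq)
  then have "h\<^sup>2 \<le> (1/2)\<^sup>2" using h2 by (simp add: power2_eq_square)
  then have h1: "h \<le> 1/2" by (rule power2_le_imp_le) simp
  note mm = mixture_mass_two_point[OF t]
  have D: "atomic {..1} w real \<in> D" "atomic {..1} w\<^sub>0 real \<in> D"
    using h0 h1 by (auto intro!: atomic_in_D simp: w_def w\<^sub>0_def)
  let ?f = "\<lambda>x::real. max 0 (min 1 x)"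
  have "(\<integral>x. ?f x \<partial>atomic {..1} w real) - (\<integral>x. ?f x \<partial>atomic {..1} w\<^sub>0 real) = h"
    using h0 h1 by (subst (1 2) integral_atomic) (auto simp: w_def w\<^sub>0_def)
  then have W: "ennreal h \<le> W1 (atomic {..1} w real) (atomic {..1} w\<^sub>0 real)"
    by (intro W1_ge_of_lipschitz[where f = ?f and L = 1 and B = 1, OF D]) auto
  have "(\<Sum>j\<in>{0..t}. (mixture_mass t {..1} w real j - mixture_mass t {..1} w\<^sub>0 real j)\<^sup>2
          / mixture_mass t {..1} w\<^sub>0 real j)
      = (\<Sum>j\<in>{0..t}. (if j = 0 then 2 * h\<^sup>2 else 0) + (if j = t then 2 * h\<^sup>2 else 0))"
  proof (rule sum.cong)
    fix j assume "j \<in> {0..t}"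
    then have "j \<le> t" by simp
    then show "(mixture_mass t {..1} w real j - mixture_mass t {..1} w\<^sub>0 real j)\<^sup>2
          / mixture_mass t {..1} w\<^sub>0 real j = (if j = 0 then 2 * h\<^sup>2 else 0) + (if j = t then 2 * h\<^sup>2 else 0)"
      using t by (simp only: mm) (auto simp: w_def w\<^sub>0_def)
  qed simp
  also have "\<dots> = 4 * h\<^sup>2" unfolding sum.distrib by simp
  finally have chi: "(\<Sum>j\<in>{0..t}. (mixture_mass t {..1} w real j - mixture_mass t {..1} w\<^sub>0 real j)\<^sup>2
          / mixture_mass t {..1} w\<^sub>0 real j) \<le> c / real n" using h2 by simp
  have ac: "mixture_mass t {..1} w real j = 0" if "j \<le> t" "mixture_mass t {..1} w\<^sub>0 real j = 0" for j
    using that(2) unfolding mm[OF that(1)] by (simp add: w\<^sub>0_def split: if_splits)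
  have "h \<le> critical_separation \<alpha> \<beta> n t"
    by (rule critical_separation_ge_atomic[OF \<alpha> \<beta> \<eta> n _ _ _ _ _ _ ac chi c(1,3) W])
       (use h0 h1 in \<open>auto simp: w_def w\<^sub>0_def\<close>)
  then show ?thesis by (simp add: h_def)
qed

lemma critical_separation_ge_inverse_t:
  assumes \<alpha>: "0 \<le> \<alpha>" and \<beta>: "0 \<le> \<beta>" "\<beta> < 1 - \<alpha>" and n: "0 < n" and t: "1 \<le> t"
  shows "critical_separation \<alpha> \<beta> n t \<ge> 1 / 16 * (1 / real t)"
proof -
  have "1 / 16 * (1 / real t) \<le> (1/2) / (2 * (real (t + 1) + 2))"
    using t by (simp add: field_simps)
  also have "\<dots> \<le> critical_separation \<alpha> \<beta> n t"
    using assms by (intro critical_separation_ge_cheb[where \<eta> = 0 and c = 0]) auto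
  finally show ?thesis .
qed

lemma critical_separation_ge_log:
  assumes \<alpha>: "0 \<le> \<alpha>" and \<beta>: "0 \<le> \<beta>" and \<eta>: "0 \<le> \<eta>" "\<beta> < 1 - \<alpha> - \<eta>"
    and c: "0 < c" "c \<le> 1" "c \<le> ln (1 + \<eta>\<^sup>2)" and t: "1 \<le> t"
    and n: "0 < n" "ln (2 / c) + 3 \<le> ln (real n)"
  shows "critical_separation \<alpha> \<beta> n t \<ge> 1 / 40 * (1 / sqrt (real t * ln (real n)))"
proof -
  define l where "l = ln (real n)"
  define K where "K = ln (2 / c)"
  have K: "0 \<le> K" using c by (simp add: K_def)
  \<comment> \<open>The summand \<open>K\<close> turns the bound \<open>2 * exp (- N)\<close> on the divergence into \<open>c / n\<close>.\<close>
  define N where "N = nat \<lceil>l + K\<rceil>"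
  have l: "3 \<le> l" "K + 3 \<le> l" using n K by (auto simp: l_def K_def)
  have N1: "l + K \<le> real N" "real N \<le> 2 * l"
    using l K unfolding N_def by linarith+
  have N2: "2 \<le> N" using N1 l K by linarith
  have e4: "3 \<le> exp (2::real)" using exp_ge_add_one_self[of 2] by simp
  have e9: "exp (2::real) \<le> 9"
  proof -
    have "exp (2::real) = exp 1 ^ 2" by (simp flip: exp_of_nat_mult)
    also have "\<dots> \<le> 3 ^ 2" by (intro power_mono exp_le) simp
    finally show ?thesis by simp
  qed
  have "1 / 40 * (1 / sqrt (real t * l)) \<le> critical_separation \<alpha> \<beta> n t"
  proof (cases "real N \<le> exp 2 * real t")
    case True
    \<comment> \<open>With this \<open>\<delta>\<close> the exponent \<open>4 * exp 2 * \<delta>\<^sup>2 * t - 2 * N\<close> is \<open>- N\<close>, and the case assumption says that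
      \<open>\<delta> \<le> 1/2\<close>.\<close>
    define \<delta> where "\<delta> = sqrt (real N / (4 * exp 2 * real t))"
    have d2: "\<delta>\<^sup>2 = real N / (4 * exp 2 * real t)" by (simp add: \<delta>_def)
    have "\<delta>\<^sup>2 \<le> (1/2)\<^sup>2" using True t unfolding d2 by (simp add: field_simps power2_eq_square)
    then have \<delta>1: "\<delta> \<le> 1/2" by (rule power2_le_imp_le) simp
    have \<delta>0: "0 < \<delta>" using N2 t by (simp add: \<delta>_def)
    have "4 * exp 2 * \<delta>\<^sup>2 * real t - 2 * real N = - real N"
      using t unfolding d2 by simp
    then have "2 * exp (4 * exp 2 * \<delta>\<^sup>2 * real t - 2 * real N) \<le> 2 * exp (- (l + K))"
      using N1 by simp
    also have "\<dots> = c / real n"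
    proof -
      have "exp l = real n" "exp K = 2 / c" using c n by (simp_all add: l_def K_def)
      then show ?thesis using c by (simp add: exp_minus exp_diff inverse_eq_divide)
    qed
    finally have "\<delta> / (2 * (real N + 2)) \<le> critical_separation \<alpha> \<beta> n t"
      using c by (intro critical_separation_ge_cheb[OF \<alpha> \<beta> \<eta> n(1) _ c(3) \<delta>0 \<delta>1 N2]) auto
    moreover have "1 / 40 * (1 / sqrt (real t * l)) \<le> \<delta> / (2 * (real N + 2))"
    proof (rule power2_le_imp_le)
      have "real N * exp 2 \<le> (2 * l) * 9" using N1 e9 l by (intro mult_mono) auto
      then have "real t * (64 * exp 2 * real N) \<le> real t * (1600 * l)"
        using l by (intro mult_left_mono) auto
      then have "1 / (1600 * (real t * l)) \<le> 1 / (64 * exp 2 * (real t * real N))"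
        using t l N2 by (intro divide_left_mono) (auto simp: mult_ac)
      also have "\<dots> = \<delta>\<^sup>2 / (4 * real N)\<^sup>2"
        using t N2 unfolding d2 by (simp add: field_simps power2_eq_square)
      also have "\<dots> \<le> \<delta>\<^sup>2 / (2 * (real N + 2))\<^sup>2"
        using N2 by (intro divide_left_mono power_mono) auto
      finally show "(1 / 40 * (1 / sqrt (real t * l)))\<^sup>2 \<le> (\<delta> / (2 * (real N + 2)))\<^sup>2"
        using l by (simp add: power_divide)
      show "0 \<le> \<delta> / (2 * (real N + 2))" using \<delta>0 by simp
    qed
    ultimately show ?thesis by linarith
  next
    case False
    have "3 * real t \<le> exp 2 * real t" using e4 by (intro mult_right_mono) auto
    then have "real t \<le> l" using False N1 t by linarith
    then have "real t \<le> sqrt (real t * l)"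
      using t by (intro real_le_rsqrt) (simp add: power2_eq_square mult_left_mono)
    then have "1 / 40 * (1 / sqrt (real t * l)) \<le> 1 / 16 * (1 / real t)"
      using t l by (intro mult_mono divide_left_mono mult_pos_pos) auto
    also have "\<dots> \<le> critical_separation \<alpha> \<beta> n t"
      using \<eta> by (intro critical_separation_ge_inverse_t \<alpha> \<beta> n t) auto
    finally show ?thesis .
  qed
  then show ?thesis by (simp add: l_def)
qed

theorem theorem3:
  fixes \<alpha> \<beta> :: real
  assumes "0 < \<alpha>" "\<alpha> < 1" and "0 < \<beta>" "\<beta> < 1 - \<alpha>"
  shows "\<exists>C>0. \<exists>n\<^sub>0::nat. \<forall>n\<ge>n\<^sub>0. \<forall>t\<ge>1. critical_separation \<alpha> \<beta> n t
           \<ge> C * max (1 / real t) (max (1 / sqrt (real t * ln (real n))) (1 / sqrt (real n)))"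
proof -
  define \<eta> where "\<eta> = (1 - \<alpha> - \<beta>) / 2"
  have \<eta>: "0 < \<eta>" "\<beta> < 1 - \<alpha> - \<eta>" using assms by (auto simp: \<eta>_def field_simps)
  define c where "c = min 1 (ln (1 + \<eta>\<^sup>2))"
  have "0 < ln (1 + \<eta>\<^sup>2)" using \<eta> by (intro ln_gt_zero) simp
  then have c: "0 < c" "c \<le> 1" "c \<le> ln (1 + \<eta>\<^sup>2)" by (auto simp: c_def)
  define C where "C = min (1/40) (sqrt c / 2)"
  have C: "0 < C" "C \<le> 1/40" "C \<le> sqrt c / 2" using c by (auto simp: C_def)
  define n\<^sub>0 where "n\<^sub>0 = nat \<lceil>exp (ln (2 / c) + 3)\<rceil>"
  have "C * max (1 / real t) (max (1 / sqrt (real t * ln (real n))) (1 / sqrt (real n)))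
      \<le> critical_separation \<alpha> \<beta> n t" if n: "n\<^sub>0 \<le> n" and t: "1 \<le> t" for n t
  proof -
    have e: "exp (ln (2 / c) + 3) \<le> real n" using n unfolding n\<^sub>0_def by linarith
    then have n0: "0 < real n" by (rule less_le_trans[OF exp_gt_zero])
    have ln: "ln (2 / c) + 3 \<le> ln (real n)" using e n0 by (simp add: ln_ge_iff)
    have \<alpha>\<beta>: "0 \<le> \<alpha>" "0 \<le> \<beta>" "0 \<le> \<eta>" using assms \<eta> by auto
    have scale: "C * a \<le> critical_separation \<alpha> \<beta> n t"
      if "b * a \<le> critical_separation \<alpha> \<beta> n t" "C \<le> b" "0 \<le> a" for a b
      using mult_right_mono[OF that(2,3)] that(1) by linarith
    have 1: "C * (1 / real t) \<le> critical_separation \<alpha> \<beta> n t"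
      using critical_separation_ge_inverse_t[of \<alpha> \<beta> n t] assms n0 t C by (intro scale[of "1/16"]) auto
    have 2: "C * (1 / sqrt (real n)) \<le> critical_separation \<alpha> \<beta> n t"
      using critical_separation_ge_two_point[of \<alpha> \<beta> \<eta> n c t] \<alpha>\<beta> \<eta> n0 t c C
      by (intro scale[of "sqrt c / 2"]) auto
    have 3: "C * (1 / sqrt (real t * ln (real n))) \<le> critical_separation \<alpha> \<beta> n t"
    proof (rule scale[of "1/40"])
      show "1 / 40 * (1 / sqrt (real t * ln (real n))) \<le> critical_separation \<alpha> \<beta> n t"
        using n0 by (intro critical_separation_ge_log[OF \<alpha>\<beta> \<eta>(2) c t _ ln]) simp
      have "0 \<le> ln (2 / c)" using c by simp
      then show "0 \<le> 1 / sqrt (real t * ln (real n))" using ln by simp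
    qed (use C in auto)
    show ?thesis using 1 2 3 by (auto simp: max_def)
  qed
  then show ?thesis using C by blast
qed

end
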